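(* For $n\geq 2k-1$, there exist non-polynomial elliptic entire solutions $u$ to the equation $$\sigma_{k}\left(D^{2}u\right)=1$$ on $\mathbb{R}^{n}$.
   Context: Here $n$ and $k$ are positive integers, $u$ is a real-valued function, and $D^2u$ denotes its Hessian matrix. For a real symmetric $n\times n$ matrix $M$ with eigenvalues $\lambda_1,\dots,\lambda_n$ (with multiplicity), $\sigma_k(M)=\sum_{1\le i_1<\dots<i_k\le n}\lambda_{i_1}\cdots\lambda_{i_k}$ is the $k$-th elementary symmetric polynomial of the eigenvalues (equivalently, the sum of the $k\times k$ principal minors of $M$). An entire solution is one defined on all of $\mathbb{R}^n$. A solution is elliptic in the sense that $D^2u(x)\in\Gamma_k^+$ for every $x\in\mathbb{R}^n$, where $\Gamma_k^+$ denotes the connected component, containing the positive definite matrices, of the set of real symmetric $n\times n$ matrices $M$ with $\sigma_k(M)>0$.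
   Formalization: The case n = k = 1 is excluded, because there the equation is u'' = 1 on the real line, whose solutions x²/2 + ax + b are all polynomials; every other case with n ≥ 2k−1 is covered. *)

theory Defs
  imports "HOL-Analysis.Analysis" "HOL-Computational_Algebra.Polynomial"
begin

definition charpoly :: "real^'n^'n \<Rightarrow> real poly" where
  "charpoly M = det (\<chi> i j. (if i = j then [:0, 1:] else 0) - [:M $ i $ j:])"

text \<open>
  An enumeration of the eigenvalues with multiplicity. The index type of the matrix also serves
  as the index set of the eigenvalues. Such an enumeration exists iff the characteristic polynomial
  splits over the reals, in particular for every symmetric matrix, and it is then unique up to a
  permutation of the indices.
\<close>

definition eigenvalue_enum :: "real^'n^'n \<Rightarrow> ('n \<Rightarrow> real) \<Rightarrow> bool" where
  "eigenvalue_enum M l \<longleftrightarrow> charpoly M = (\<Prod>i\<in>UNIV. [:- l i, 1:])"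

definition eigenvalues :: "real^'n^'n \<Rightarrow> 'n \<Rightarrow> real" where
  "eigenvalues M = (SOME l. eigenvalue_enum M l)"

text \<open>
  The sum over \<open>i\<^sub>1 < \<dots> < i\<^sub>k\<close> is the sum over the \<open>k\<close>-element sets of indices. By symmetry
  of this expression the choice of enumeration does not matter. It is meant for symmetric matrices
  only.
\<close>

definition sigma :: "nat \<Rightarrow> real^'n^'n \<Rightarrow> real" where
  "sigma k M = (\<Sum>I\<in>{I. card I = k}. \<Prod>i\<in>I. eigenvalues M i)"

text \<open>
  The positive definite matrices form a convex set on which \<^term>\<open>sigma k\<close> is positive (for
  \<open>k\<close> at most the dimension), so the component containing them is the one of the identity matrix.
\<close>

definition Gamma_plus :: "nat \<Rightarrow> (real^'n^'n) set" where
  "Gamma_plus k = connected_component_set {M. transpose M = M \<and> sigma k M > 0} (mat 1)"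

definition grad :: "(real^'n \<Rightarrow> real) \<Rightarrow> real^'n \<Rightarrow> real^'n" where
  "grad u x = (\<chi> i. frechet_derivative u (at x) (axis i 1))"

definition hessian :: "(real^'n \<Rightarrow> real) \<Rightarrow> real^'n \<Rightarrow> real^'n^'n" where
  "hessian u x = jacobian (grad u) (at x)"

definition twice_cont_differentiable :: "(real^'n \<Rightarrow> real) \<Rightarrow> bool" where
  "twice_cont_differentiable u \<longleftrightarrow>
     (\<forall>x. u differentiable (at x)) \<and> (\<forall>x. grad u differentiable (at x)) \<and>
     continuous_on UNIV (hessian u)"

definition elliptic_entire_solution :: "nat \<Rightarrow> (real^'n \<Rightarrow> real) \<Rightarrow> bool" where
  "elliptic_entire_solution k u \<longleftrightarrow>
     twice_cont_differentiable u \<and>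
     (\<forall>x. sigma k (hessian u x) = 1) \<and> (\<forall>x. hessian u x \<in> Gamma_plus k)"

end

theory Submission
  imports Defs
begin

text \<open>
  For \<open>k = j + 1 \<ge> 2\<close> single out one coordinate \<open>t\<close> and a set \<open>S\<close> of \<open>2j\<close> others, and let
  \<open>u = e\<^sup>t |x|\<^sup>2 / 2 + h t\<close> with \<open>|x|\<^sup>2\<close> summed over \<open>S\<close>; the remaining coordinates only contribute zero
  eigenvalues. The Hessian is an arrow matrix with \<open>e\<^sup>t\<close> repeated \<open>2j\<close> times on the diagonal, corner
  entry \<open>c = e\<^sup>t |x|\<^sup>2 / 2 + h'' t\<close> and border \<open>e\<^sup>t x\<close>, so that \<open>\<sigma>\<^sub>k\<close> equals
  \<open>C(2j, k) e\<^bsup>kt\<^esup> + C(2j, j) e\<^bsup>jt\<^esup> c - C(2j - 1, j - 1) e\<^bsup>kt\<^esup> |x|\<^sup>2\<close>. Since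
  \<open>C(2j, j) = 2 C(2j - 1, j - 1)\<close>, the terms with \<open>|x|\<^sup>2\<close> cancel, and \<open>\<sigma>\<^sub>k = 1\<close> becomes
  \<open>h'' t = (e\<^bsup>-jt\<^esup> - C(2j, k) e\<^sup>t) / C(2j, j)\<close>, which a combination of \<open>e\<^bsup>-jt\<^esup>\<close> and \<open>e\<^sup>t\<close> solves.
  For \<open>k = 1\<close> add a quadratic to the harmonic function \<open>e\<^sup>x cos y\<close>.
\<close>

section \<open>Arrow matrices, their determinant and characteristic polynomial\<close>

definition arrow :: "'n \<Rightarrow> ('n \<Rightarrow> 'a) \<Rightarrow> ('n \<Rightarrow> 'a) \<Rightarrow> 'a::zero^'n^'n" where
  "arrow t d v = (\<chi> i j. if i = j then d i else if i = t then v j else if j = t then v i else 0)"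

lemma transpose_arrow: "transpose (arrow t d v) = arrow t d v"
  by (auto simp: arrow_def transpose_def vec_eq_iff)

lemma mat_1_eq_arrow: "mat 1 = arrow t (\<lambda>_. 1) (\<lambda>_. 0)"
  by (auto simp: arrow_def mat_def vec_eq_iff)

text \<open>Arrow matrices with a common tip \<open>t\<close> form a linear subspace, so segments
  between them stay in the family.\<close>

lemma arrow_convex_combination:
  fixes d e v w :: "'n::finite \<Rightarrow> real"
  shows "(1 - s) *\<^sub>R arrow t d v + s *\<^sub>R arrow t e w
    = arrow t (\<lambda>i. (1 - s) * d i + s * e i) (\<lambda>i. (1 - s) * v i + s * w i)"
  by (auto simp: arrow_def vec_eq_iff)

text \<open>The added vector lies in the span of the other rows, so a whole series of eliminations
  becomes one step.\<close>

lemma det_add_row_combination: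
  fixes A :: "'a::field^'n^'n"
  shows "det (\<chi> k. if k = t then row t A + (\<Sum>i\<in>UNIV - {t}. c i *s row i A) else row k A) = det A"
  by (intro det_row_span vec.span_sum vec.span_scale vec.span_base) auto

text \<open>Eliminating the off-diagonal part of row \<open>t\<close> and then of column \<open>t\<close> leaves a diagonal matrix.\<close>

lemma det_arrow:
  fixes d v :: "'n::finite \<Rightarrow> 'a::field"
  assumes nz: "\<And>i. i \<noteq> t \<Longrightarrow> d i \<noteq> 0"
  shows "det (arrow t d v) = (\<Prod>i\<in>UNIV - {t}. d i) * (d t - (\<Sum>i\<in>UNIV - {t}. v i ^ 2 / d i))"
proof -
  \<comment> \<open>The new entry at \<open>t\<close> is a Schur complement. \<open>B\<close> is the
    matrix after the row elimination, \<open>D\<close> the one after the column elimination.\<close>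
  define e where "e = d(t := d t - (\<Sum>i\<in>UNIV - {t}. v i ^ 2 / d i))"
  define B :: "'a^'n^'n" where
    "B = (\<chi> i j. if i = j then e i else if j = t then v i else 0)"
  define D :: "'a^'n^'n" where "D = (\<chi> i j. if i = j then e i else 0)"
  have s: "(\<Sum>i\<in>UNIV - {t}. c i * (if i = j then b i else 0)) = (if j = t then 0 else c j * b j)"
    for c b :: "'n \<Rightarrow> 'a" and j
    by (subst sum.mono_neutral_right[of _ "if j = t then {} else {j}"]) auto
  have "B = (\<chi> k. if k = t then row t (arrow t d v)
      + (\<Sum>i\<in>UNIV - {t}. (- v i / d i) *s row i (arrow t d v)) else row k (arrow t d v))"
  proof -
    have "B $ t $ t = d t + (\<Sum>i\<in>UNIV - {t}. (- v i / d i) * v i)"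
      by (simp add: B_def e_def sum_negf power2_eq_square flip: sum_negf)
    also have "(\<Sum>i\<in>UNIV - {t}. (- v i / d i) * v i)
        = (\<Sum>i\<in>UNIV - {t}. (- v i / d i) * arrow t d v $ i $ t)"
      by (rule sum.cong) (auto simp: arrow_def)
    finally have 1: "B $ t $ t = d t + (\<Sum>i\<in>UNIV - {t}. (- v i / d i) * arrow t d v $ i $ t)" .
    have 2: "B $ t $ j = v j + (\<Sum>i\<in>UNIV - {t}. (- v i / d i) * arrow t d v $ i $ j)" if "j \<noteq> t" for j
    proof -
      have "(\<Sum>i\<in>UNIV - {t}. (- v i / d i) * arrow t d v $ i $ j)
        = (\<Sum>i\<in>UNIV - {t}. (- v i / d i) * (if i = j then d i else 0))"
        using that by (intro sum.cong) (auto simp: arrow_def)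
      then show ?thesis
        unfolding s using that nz[OF that] by (auto simp: B_def)
    qed
    show ?thesis
    proof (unfold vec_eq_iff, intro allI)
      fix i j
      show "B $ i $ j = (\<chi> k. if k = t then row t (arrow t d v)
        + (\<Sum>i\<in>UNIV - {t}. (- v i / d i) *s row i (arrow t d v)) else row k (arrow t d v)) $ i $ j"
        using 1 2[of j]
        by (cases "i = t"; cases "j = t")
          (simp_all add: row_def, auto simp: arrow_def B_def e_def)
    qed
  qed
  then have "det (arrow t d v) = det B"
    by (simp only: det_add_row_combination)
  also have "\<dots> = det (transpose B)"
    by simp
  \<comment> \<open>Column operations on \<open>B\<close> are row operations on its transpose, whose
    border sits in row \<open>t\<close> alone.\<close>
  also have "D = (\<chi> k. if k = t then row t (transpose B)
      + (\<Sum>i\<in>UNIV - {t}. (- v i / d i) *s row i (transpose B)) else row k (transpose B))"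
  proof (unfold vec_eq_iff, intro allI)
    fix i j
    have "(\<Sum>i\<in>UNIV - {t}. (- v i / d i) * transpose B $ i $ j)
      = (\<Sum>i\<in>UNIV - {t}. (- v i / d i) * (if i = j then d i else 0))"
      by (intro sum.cong) (auto simp: B_def transpose_def e_def)
    then have "(\<Sum>i\<in>UNIV - {t}. (- v i / d i) * transpose B $ i $ j) = (if j = t then 0 else - v j)"
      unfolding s using nz by auto
    then show "D $ i $ j = (\<chi> k. if k = t then row t (transpose B)
      + (\<Sum>i\<in>UNIV - {t}. (- v i / d i) *s row i (transpose B)) else row k (transpose B)) $ i $ j"
      by (cases "i = t") (simp_all add: row_def, auto simp: B_def D_def transpose_def)
  qed
  then have "det (transpose B) = det D"
    by (simp only: det_add_row_combination)
  also have "\<dots> = (\<Prod>i\<in>UNIV. e i)"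
    by (subst det_diagonal) (auto simp: D_def)
  also have "\<dots> = (\<Prod>i\<in>UNIV - {t}. e i) * e t"
    by (subst prod.remove[of _ t]) auto
  also have "(\<Prod>i\<in>UNIV - {t}. e i) = (\<Prod>i\<in>UNIV - {t}. d i)"
    by (rule prod.cong) (auto simp: e_def)
  finally show ?thesis by (simp add: e_def)
qed

lemma poly_det: "poly (det M) x = det (\<chi> i j. poly (M $ i $ j) x)"
  for M :: "'a::comm_ring_1 poly^'n^'n"
  by (simp add: det_def poly_sum poly_prod)

lemma charpoly_arrow_diagonal: "charpoly (arrow t d (\<lambda>_. 0)) = (\<Prod>i\<in>UNIV. [:- d i, 1:])"
  unfolding charpoly_def
  by (subst det_diagonal) (auto simp: arrow_def)

text \<open>Off the diagonal entries \<open>det_arrow\<close> applies. Nonzero border entries only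
  meet the value \<open>d p\<close>, so all fractions share the denominator \<open>x - d p\<close>,
  which cancels against the factor of \<open>p\<close> and leaves a quadratic. Agreement at
  infinitely many points then gives equality of polynomials.\<close>

lemma charpoly_arrow:
  fixes d v :: "'n::finite \<Rightarrow> real"
  assumes "p \<noteq> t" and eq: "\<And>i. i \<noteq> t \<Longrightarrow> v i \<noteq> 0 \<Longrightarrow> d i = d p"
  shows "charpoly (arrow t d v) = (\<Prod>i\<in>UNIV - {t, p}. [:- d i, 1:])
    * [:d t * d p - (\<Sum>i\<in>UNIV - {t}. v i ^ 2), - (d t + d p), 1:]" (is "?L = ?R")
proof -
  define q where "q = (\<Sum>i\<in>UNIV - {t}. v i ^ 2)"
  have ev: "poly ?L x = poly ?R x" if x: "x \<notin> range d" for x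
  proof -
    have "poly ?L x = det (arrow t (\<lambda>i. x - d i) (\<lambda>i. - v i))"
      unfolding charpoly_def poly_det
      by (rule arg_cong[where f = det]) (auto simp: arrow_def vec_eq_iff)
    also have "\<dots> = (\<Prod>i\<in>UNIV - {t}. x - d i) * (x - d t - (\<Sum>i\<in>UNIV - {t}. v i ^ 2 / (x - d i)))"
      using x by (subst det_arrow) auto
    also have "(\<Sum>i\<in>UNIV - {t}. v i ^ 2 / (x - d i)) = (\<Sum>i\<in>UNIV - {t}. v i ^ 2 / (x - d p))"
    proof (rule sum.cong)
      show "v i ^ 2 / (x - d i) = v i ^ 2 / (x - d p)" if "i \<in> UNIV - {t}" for i
        using eq[of i] that by (cases "v i = 0") auto
    qed simp
    also have "\<dots> = q / (x - d p)"
      by (simp add: q_def sum_divide_distrib)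
    also have "(\<Prod>i\<in>UNIV - {t}. x - d i) = (x - d p) * (\<Prod>i\<in>UNIV - {t, p}. x - d i)"
      using assms(1) by (subst prod.remove[of _ p]) (auto intro!: prod.cong)
    also have "(x - d p) * (\<Prod>i\<in>UNIV - {t, p}. x - d i) * (x - d t - q / (x - d p)) = poly ?R x"
    proof -
      have "x - d p \<noteq> 0" using x by auto
      then show ?thesis
        unfolding q_def[symmetric] by (simp add: poly_prod field_simps)
    qed
    finally show ?thesis .
  qed
  have "infinite (UNIV - range d)"
    by (simp add: Diff_infinite_finite infinite_UNIV_char_0)
  moreover have "UNIV - range d \<subseteq> {x. poly (?L - ?R) x = 0}"
    using ev by auto
  ultimately have "infinite {x. poly (?L - ?R) x = 0}"
    by (rule infinite_super[rotated])
  then show ?thesis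
    using poly_roots_finite[of "?L - ?R"] by auto
qed

section \<open>Elementary symmetric functions of the eigenvalues\<close>

text \<open>Reversing the characteristic polynomial puts \<open>\<sigma>\<^sub>k\<close>, up to sign, into the
  coefficient of degree \<open>k\<close>, whatever the dimension.\<close>

definition esym_poly :: "'a set \<Rightarrow> ('a \<Rightarrow> real) \<Rightarrow> real poly" where
  "esym_poly A l = (\<Prod>i\<in>A. [:1, l i:])"

lemma coeff_esym_poly:
  assumes "finite A"
  shows "coeff (esym_poly A l) k = (\<Sum>I\<in>{I. I \<subseteq> A \<and> card I = k}. \<Prod>i\<in>I. l i)"
proof -
  have "esym_poly A l = (\<Prod>i\<in>A. monom (l i) 1 + 1)"
    unfolding esym_poly_def by (intro prod.cong) (auto simp: monom_altdef one_pCons)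
  also have "\<dots> = (\<Sum>I\<in>Pow A. \<Prod>i\<in>I. monom (l i) 1)"
    using assms by (simp add: prod_add)
  also have "\<dots> = (\<Sum>I\<in>Pow A. monom (\<Prod>i\<in>I. l i) (card I))"
  proof (rule sum.cong)
    fix I assume "I \<in> Pow A"
    then have "finite I" using assms finite_subset by auto
    then show "(\<Prod>i\<in>I. monom (l i) 1) = monom (\<Prod>i\<in>I. l i) (card I)"
      by (induction I rule: finite_induct) (auto simp: mult_monom)
  qed simp
  finally have "coeff (esym_poly A l) k = (\<Sum>I\<in>Pow A. if card I = k then \<Prod>i\<in>I. l i else 0)"
    by (simp add: coeff_sum)
  also have "\<dots> = (\<Sum>I\<in>{I. I \<subseteq> A \<and> card I = k}. \<Prod>i\<in>I. l i)"
    using assms by (intro sum.mono_neutral_cong_right) auto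
  finally show ?thesis .
qed

lemma esym_poly_eq_reflect_poly:
  "esym_poly A l = pcompose (reflect_poly (\<Prod>i\<in>A. [:- l i, 1:])) [:0, -1:]"
proof -
  have "reflect_poly [:- x, 1:] = [:1, - x:]" for x :: real
    by (rule poly_eqI) (auto simp: reflect_poly_def coeff_pCons split: nat.split)
  then show ?thesis
    by (simp add: esym_poly_def reflect_poly_prod pcompose_prod pcompose_pCons)
qed

text \<open>The enumeration chosen by \<open>SOME\<close> may differ from \<open>l\<close>, but
  \<open>esym_poly\<close> depends only on the characteristic polynomial, by
  \<open>esym_poly_eq_reflect_poly\<close>.\<close>

lemma sigma_eq_coeff_esym_poly:
  fixes M :: "real^'n^'n" and l :: "'n \<Rightarrow> real"
  assumes "charpoly M = (\<Prod>i\<in>UNIV. [:- l i, 1:])"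
  shows "sigma k M = coeff (esym_poly UNIV l) k"
proof -
  have "eigenvalue_enum M (eigenvalues M)"
    unfolding eigenvalues_def by (rule someI[of "eigenvalue_enum M" l]) (simp add: eigenvalue_enum_def assms)
  then have "(\<Prod>i\<in>UNIV. [:- eigenvalues M i, 1:]) = (\<Prod>i\<in>UNIV. [:- l i, 1:])"
    by (simp add: eigenvalue_enum_def assms)
  then have "esym_poly UNIV (eigenvalues M) = esym_poly UNIV l"
    by (simp add: esym_poly_eq_reflect_poly)
  then show ?thesis
    by (simp add: sigma_def flip: coeff_esym_poly[OF finite_class.finite_UNIV, simplified])
qed

lemma sigma_arrow_diagonal: "sigma k (arrow t d (\<lambda>_. 0)) = coeff (esym_poly UNIV d) k"
  by (rule sigma_eq_coeff_esym_poly) (rule charpoly_arrow_diagonal)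

text \<open>These are the eigenvalues of a symmetric 2 by 2 matrix with diagonal \<open>a\<close>,
  \<open>c\<close> and squared off-diagonal entry \<open>q\<close>; the discriminant is a sum of
  nonnegative terms.\<close>

lemma real_roots_quadratic:
  fixes a c q :: real
  assumes "q \<ge> 0"
  obtains x y where "x + y = a + c" "x * y = a * c - q"
proof
  define r where "r = sqrt ((a - c)\<^sup>2 + 4 * q)"
  have r: "r\<^sup>2 = (a - c)\<^sup>2 + 4 * q"
    using assms by (simp add: r_def)
  show "(a + c + r) / 2 + (a + c - r) / 2 = a + c"
    by (simp add: field_simps)
  show "(a + c + r) / 2 * ((a + c - r) / 2) = a * c - q"
    using r by (simp add: power2_eq_square field_simps)
qed

text \<open>The roots \<open>x\<close>, \<open>y\<close> of the quadratic factor replace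
  \<open>d t\<close> and \<open>d p\<close> among the eigenvalues. Their sum is unchanged and their
  product drops by \<open>q\<close>, so the generating polynomial loses \<open>q\<close> times the
  square of the variable times the product over the other indices. This affects no degree below
  two.\<close>

lemma sigma_arrow:
  fixes d v :: "'n::finite \<Rightarrow> real"
  assumes pt: "p \<noteq> t" and eq: "\<And>i. i \<noteq> t \<Longrightarrow> v i \<noteq> 0 \<Longrightarrow> d i = d p"
  shows "sigma k (arrow t d v) = coeff (esym_poly UNIV d) k
    - (\<Sum>i\<in>UNIV - {t}. v i ^ 2) * (if k < 2 then 0 else coeff (esym_poly (UNIV - {t, p}) d) (k - 2))"
proof -
  define q where "q = (\<Sum>i\<in>UNIV - {t}. v i ^ 2)"
  have "q \<ge> 0" by (simp add: q_def sum_nonneg)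
  then obtain x y where xy: "x + y = d t + d p" "x * y = d t * d p - q"
    by (rule real_roots_quadratic)
  define l where "l = d(t := x, p := y)"
  have split: "(\<Prod>i\<in>UNIV. f i) = (\<Prod>i\<in>UNIV - {t, p}. f i) * (f t * f p)" for f :: "'n \<Rightarrow> real poly"
  proof -
    have "UNIV - {t, p} = UNIV - {t} - {p}" by auto
    then show ?thesis
      using pt by (simp add: prod.remove[of UNIV t] prod.remove[of "UNIV - {t}" p] mult_ac)
  qed
  have off: "(\<Prod>i\<in>UNIV - {t, p}. f (l i)) = (\<Prod>i\<in>UNIV - {t, p}. f (d i))" for f :: "real \<Rightarrow> real poly"
    by (rule prod.cong) (auto simp: l_def)
  have charpoly_arrow_split: "charpoly (arrow t d v)
      = (\<Prod>i\<in>UNIV - {t, p}. [:- d i, 1:]) * [:d t * d p - q, - (d t + d p), 1:]"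
    unfolding q_def by (rule charpoly_arrow) (use pt eq in auto)
  have "charpoly (arrow t d v) = (\<Prod>i\<in>UNIV. [:- l i, 1:])"
  proof -
    have "[:- l t, 1:] * [:- l p, 1:] = [:d t * d p - q, - (d t + d p), 1:]"
      using pt xy by (auto simp: l_def mult.commute)
    then show ?thesis
      unfolding split off[of "\<lambda>x. [:- x, 1:]"] charpoly_arrow_split by simp
  qed
  then have "sigma k (arrow t d v) = coeff (esym_poly UNIV l) k"
    by (rule sigma_eq_coeff_esym_poly)
  also have "esym_poly UNIV l = esym_poly (UNIV - {t, p}) d * [:1, d t + d p, d t * d p - q:]"
  proof -
    have "[:1, l t:] * [:1, l p:] = [:1, d t + d p, d t * d p - q:]"
      using pt xy by (auto simp: l_def mult.commute)
    then show ?thesis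
      unfolding esym_poly_def split off[of "\<lambda>x. [:1, x:]"] by simp
  qed
  also have "\<dots> = esym_poly (UNIV - {t, p}) d * ([:1, d t:] * [:1, d p:])
      - monom q 2 * esym_poly (UNIV - {t, p}) d"
  proof -
    have "[:1, d t + d p, d t * d p - q:] = [:1, d t:] * [:1, d p:] - monom q 2"
      by (simp add: monom_altdef power2_eq_square mult.commute)
    then show ?thesis
      by (simp only: right_diff_distrib mult.commute)
  qed
  also have "esym_poly (UNIV - {t, p}) d * ([:1, d t:] * [:1, d p:]) = esym_poly UNIV d"
    unfolding esym_poly_def split ..
  finally show ?thesis
    by (simp add: coeff_monom_mult q_def)
qed

lemma coeff_0_esym_poly [simp]: "coeff (esym_poly A d) 0 = 1"
  by (simp add: esym_poly_def poly_prod flip: poly_0_coeff_0)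

lemma coeff_1_esym_poly: "finite A \<Longrightarrow> coeff (esym_poly A d) (Suc 0) = (\<Sum>i\<in>A. d i)"
proof (induction A rule: finite_induct)
  case empty
  then show ?case by (simp add: esym_poly_def)
next
  case (insert i A)
  then have "esym_poly (insert i A) d = esym_poly A d * [:1, d i:]"
    by (simp add: esym_poly_def mult.commute)
  then have "esym_poly (insert i A) d = esym_poly A d + pCons 0 (smult (d i) (esym_poly A d))"
    by (simp add: algebra_simps)
  with insert show ?case by simp
qed

text \<open>No summand is negative, and a \<open>k\<close>-element subset of \<open>B\<close> gives
  a positive one.\<close>

lemma coeff_esym_poly_pos:
  assumes "finite A" "\<And>i. i \<in> A \<Longrightarrow> d i \<ge> 0" "B \<subseteq> A" "\<And>i. i \<in> B \<Longrightarrow> d i > 0" "k \<le> card B"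
  shows "coeff (esym_poly A d) k > 0"
proof -
  obtain I where I: "I \<subseteq> B" "card I = k"
    using obtain_subset_with_card_n[OF assms(5)] by blast
  show ?thesis
    unfolding coeff_esym_poly[OF assms(1)]
  proof (rule sum_pos2[of _ I])
    show "finite {I. I \<subseteq> A \<and> card I = k}"
      using assms(1) by simp
    show "I \<in> {I. I \<subseteq> A \<and> card I = k}"
      using I assms(3) by simp
    show "(\<Prod>i\<in>I. d i) > 0"
      using I(1) assms(4) by (intro prod_pos) blast
    show "(\<Prod>i\<in>J. d i) \<ge> 0" if "J \<in> {I. I \<subseteq> A \<and> card I = k}" for J
      using that assms(2) by (intro prod_nonneg) blast
  qed
qed

lemma coeff_one_linear_poly_power: "coeff ([:1, a:] ^ m) k = of_nat (m choose k) * a ^ k"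
  for a :: real
proof (cases "k \<le> m")
  case False
  have "degree ([:1, a:] ^ m) \<le> degree [:1, a:] * m"
    by (rule degree_power_le)
  also have "\<dots> \<le> 1 * m"
    by (intro mult_right_mono) auto
  finally show ?thesis using False by (simp add: coeff_eq_0)
qed (simp add: coeff_linear_poly_power)

section \<open>Arrow matrices with a constant diagonal block, and paths to the identity\<close>

lemma connected_component_arrow:
  fixes d e v w :: "'n::finite \<Rightarrow> real"
  assumes "\<And>s. 0 \<le> s \<Longrightarrow> s \<le> 1 \<Longrightarrow>
    sigma k (arrow t (\<lambda>i. (1 - s) * d i + s * e i) (\<lambda>i. (1 - s) * v i + s * w i)) > 0"
  shows "connected_component {M. transpose M = M \<and> sigma k M > 0} (arrow t d v) (arrow t e w)"
proof (rule connected_componentI)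
  show "connected (closed_segment (arrow t d v) (arrow t e w))"
    by simp
  show "closed_segment (arrow t d v) (arrow t e w) \<subseteq> {M. transpose M = M \<and> sigma k M > 0}"
    using assms by (auto simp: closed_segment_def arrow_convex_combination transpose_arrow)
qed auto

text \<open>The diagonal of the Hessians built below; its zeros belong to coordinates on which the
  solution does not depend.\<close>

definition spike :: "'n \<Rightarrow> 'n set \<Rightarrow> real \<Rightarrow> real \<Rightarrow> 'n \<Rightarrow> real" where
  "spike t S c a i = (if i = t then c else if i \<in> S then a else 0)"

lemma sum_spike:
  fixes t :: "'n::finite"
  assumes "t \<notin> S"
  shows "(\<Sum>i\<in>UNIV. if i = t then b else if i \<in> S then f i else 0) = b + sum f S"
proof -
  have "(\<Sum>i\<in>UNIV. if i = t then b else if i \<in> S then f i else 0)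
    = b + (\<Sum>i\<in>UNIV - {t}. if i = t then b else if i \<in> S then f i else 0)"
    by (subst sum.remove[of _ t]) auto
  also have "(\<Sum>i\<in>UNIV - {t}. if i = t then b else if i \<in> S then f i else 0) = sum f S"
    using assms by (intro sum.mono_neutral_cong_right) auto
  finally show ?thesis .
qed

text \<open>Zero entries contribute the factor 1, so surplus dimensions have no effect.\<close>

lemma esym_poly_spike:
  fixes t :: "'n::finite"
  assumes "t \<notin> S"
  shows "esym_poly UNIV (spike t S c a) = [:1, c:] * [:1, a:] ^ card S"
    and "p \<in> S \<Longrightarrow> esym_poly (UNIV - {t, p}) (spike t S c a) = [:1, a:] ^ (card S - 1)"
proof -
  have "esym_poly (UNIV - {t}) (spike t S c a) = (\<Prod>i\<in>S. [:1, a:])"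
    unfolding esym_poly_def
    using assms by (intro prod.mono_neutral_cong_right) (auto simp: spike_def)
  then show "esym_poly UNIV (spike t S c a) = [:1, c:] * [:1, a:] ^ card S"
    unfolding esym_poly_def by (subst prod.remove[of _ t]) (auto simp: spike_def)
  assume "p \<in> S"
  have "esym_poly (UNIV - {t, p}) (spike t S c a) = (\<Prod>i\<in>S - {p}. [:1, a:])"
    unfolding esym_poly_def
    using assms by (intro prod.mono_neutral_cong_right) (auto simp: spike_def)
  then show "esym_poly (UNIV - {t, p}) (spike t S c a) = [:1, a:] ^ (card S - 1)"
    using \<open>p \<in> S\<close> by simp
qed

text \<open>Writing the degree as \<open>Suc (Suc k)\<close> removes the case distinction of
  \<open>sigma_arrow\<close>.\<close>

lemma sigma_spike:
  fixes v :: "'n::finite \<Rightarrow> real" and a c :: real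
  assumes "t \<notin> S" "p \<in> S" and v: "\<And>i. i \<noteq> t \<Longrightarrow> i \<notin> S \<Longrightarrow> v i = 0"
  shows "sigma (Suc (Suc k)) (arrow t (spike t S c a) v)
    = (card S choose Suc (Suc k)) * a ^ Suc (Suc k) + c * (card S choose Suc k) * a ^ Suc k
      - (\<Sum>i\<in>UNIV - {t}. v i ^ 2) * (((card S - 1) choose k) * a ^ k)"
proof -
  have "coeff ([:1 :: real, c:] * [:1, a:] ^ card S) (Suc (Suc k))
    = (card S choose Suc (Suc k)) * a ^ Suc (Suc k) + c * (card S choose Suc k) * a ^ Suc k"
    by (simp only: mult_pCons_left coeff_add coeff_smult coeff_pCons_Suc coeff_one_linear_poly_power) simp
  moreover have "sigma (Suc (Suc k)) (arrow t (spike t S c a) v)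
    = coeff (esym_poly UNIV (spike t S c a)) (Suc (Suc k))
      - (\<Sum>i\<in>UNIV - {t}. v i ^ 2) * coeff (esym_poly (UNIV - {t, p}) (spike t S c a)) k"
    by (subst sigma_arrow[of p]) (use assms in \<open>auto simp: spike_def\<close>)
  ultimately show ?thesis
    by (simp only: esym_poly_spike[OF assms(1)] esym_poly_spike(2)[OF assms(1,2)] coeff_one_linear_poly_power)
qed

text \<open>Three line segments lead to the identity matrix: remove the off-diagonal entries, which only
  increases \<open>\<sigma>\<^sub>k\<close>, then move the corner entry \<open>c\<close> to \<open>a\<close>, then all diagonal entries to \<open>1\<close>.\<close>

lemma spike_in_Gamma_plus:
  fixes v :: "'n::finite \<Rightarrow> real"
  assumes tS: "t \<notin> S" and pS: "p \<in> S" and v: "\<And>i. i \<noteq> t \<Longrightarrow> i \<notin> S \<Longrightarrow> v i = 0"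
    and "a > 0" and card: "Suc (Suc k) \<le> card S"
    and pos: "sigma (Suc (Suc k)) (arrow t (spike t S c a) v) > 0"
  shows "arrow t (spike t S c a) v \<in> Gamma_plus (Suc (Suc k))"
proof -
  let ?P = "{M :: real^'n^'n. transpose M = M \<and> sigma (Suc (Suc k)) M > 0}"
  \<comment> \<open>In these terms \<sigma> is \<open>K + c * L - q * C\<close>: affine in the
    corner and nonincreasing in the squared border norm \<open>q\<close>.\<close>
  define K where "K = (card S choose Suc (Suc k)) * a ^ Suc (Suc k)"
  define L where "L = (card S choose Suc k) * a ^ Suc k"
  define q where "q = (\<Sum>i\<in>UNIV - {t}. v i ^ 2)"
  define C where "C = ((card S - 1) choose k) * a ^ k"
  have nonneg: "K \<ge> 0" "L > 0" "q \<ge> 0" "C \<ge> 0"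
    using \<open>a > 0\<close> card by (auto simp: K_def L_def q_def C_def sum_nonneg)
  have sigma: "sigma (Suc (Suc k)) (arrow t (spike t S c' a) w) = K + c' * L - (\<Sum>i\<in>UNIV - {t}. w i ^ 2) * C"
    if "\<And>i. i \<noteq> t \<Longrightarrow> i \<notin> S \<Longrightarrow> w i = 0" for c' and w :: "'n \<Rightarrow> real"
    using sigma_spike[OF tS pS, of w k c' a] that by (simp add: K_def L_def C_def)
  have pos': "K + c * L - q * C > 0"
    using pos sigma[of v c] v by (simp add: q_def)
  have "connected_component ?P (arrow t (spike t S c a) v) (arrow t (spike t S c a) (\<lambda>_. 0))"
  proof (rule connected_component_arrow)
    fix s :: real assume s: "0 \<le> s" "s \<le> 1"
    have "(1 - s)\<^sup>2 * q * C \<le> 1 * q * C"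
      using s nonneg by (intro mult_right_mono) (auto simp: power_le_one)
    then have "K + c * L - (1 - s)\<^sup>2 * q * C > 0"
      using pos' by simp
    moreover have "(\<lambda>i. (1 - s) * spike t S c a i + s * spike t S c a i) = spike t S c a"
      by (simp add: algebra_simps)
    ultimately show "sigma (Suc (Suc k)) (arrow t (\<lambda>i. (1 - s) * spike t S c a i + s * spike t S c a i)
        (\<lambda>i. (1 - s) * v i + s * 0)) > 0"
      using v by (simp add: sigma power_mult_distrib q_def sum_distrib_left sum_distrib_right)
  qed
  moreover have "connected_component ?P (arrow t (spike t S c a) (\<lambda>_. 0)) (arrow t (spike t S a a) (\<lambda>_. 0))"
  proof (rule connected_component_arrow)
    fix s :: real assume s: "0 \<le> s" "s \<le> 1"
    have "(\<lambda>i. (1 - s) * spike t S c a i + s * spike t S a a i) = spike t S ((1 - s) * c + s * a) a"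
      by (auto simp: spike_def algebra_simps)
    moreover have "K + ((1 - s) * c + s * a) * L > 0"
    proof -
      have "q * C \<ge> 0" using nonneg by simp
      then have 1: "K + c * L > 0" using pos' by linarith
      have 2: "K + a * L > 0" using nonneg \<open>a > 0\<close> by (simp add: add_nonneg_pos)
      have "(1 - s) * (K + c * L) + s * (K + a * L) > 0"
        using 1 2 s by (cases "s = 0") (auto intro: add_nonneg_pos)
      then show ?thesis by (simp add: algebra_simps)
    qed
    ultimately show "sigma (Suc (Suc k)) (arrow t (\<lambda>i. (1 - s) * spike t S c a i + s * spike t S a a i)
        (\<lambda>i. (1 - s) * 0 + s * 0)) > 0"
      by (simp add: sigma)
  qed
  moreover have "connected_component ?P (arrow t (spike t S a a) (\<lambda>_. 0)) (arrow t (\<lambda>_. 1) (\<lambda>_. 0))"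
  proof (rule connected_component_arrow)
    fix s :: real assume s: "0 \<le> s" "s \<le> 1"
    \<comment> \<open>At \<open>s = 0\<close> the entries outside \<open>S\<close> and
      \<open>t\<close> vanish, so positivity has to come from \<open>S\<close>, which is large
      enough by \<open>card\<close>.\<close>
    have "coeff (esym_poly UNIV (\<lambda>i. (1 - s) * spike t S a a i + s * 1)) (Suc (Suc k)) > 0"
    proof (rule coeff_esym_poly_pos[where B = S])
      show "(1 - s) * spike t S a a i + s * 1 > 0" if "i \<in> S" for i
        using s \<open>a > 0\<close> that by (cases "s = 0") (auto simp: spike_def intro: add_nonneg_pos)
    qed (use s \<open>a > 0\<close> card in \<open>auto simp: spike_def\<close>)
    then show "sigma (Suc (Suc k)) (arrow t (\<lambda>i. (1 - s) * spike t S a a i + s * 1)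
        (\<lambda>i. (1 - s) * 0 + s * 0)) > 0"
      by (simp add: sigma_arrow_diagonal)
  qed
  ultimately have "connected_component ?P (arrow t (spike t S c a) v) (mat 1)"
    unfolding mat_1_eq_arrow[of t] using connected_component_trans by blast
  then show ?thesis
    by (simp add: Gamma_plus_def connected_component_sym_eq)
qed

text \<open>The border first enters in degree two, so degree one sees only the trace.\<close>

lemma sigma_1_arrow:
  fixes d v :: "'n::finite \<Rightarrow> real"
  assumes "p \<noteq> t" "\<And>i. i \<noteq> t \<Longrightarrow> v i \<noteq> 0 \<Longrightarrow> d i = d p"
  shows "sigma (Suc 0) (arrow t d v) = (\<Sum>i\<in>UNIV. d i)"
  using sigma_arrow[of p t v d "Suc 0"] assms by (simp add: coeff_1_esym_poly)

text \<open>The trace is linear, so a single segment to the identity suffices.\<close>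

lemma arrow_in_Gamma_plus_1:
  fixes d v :: "'n::finite \<Rightarrow> real"
  assumes "p \<noteq> t" and v: "\<And>i. i \<noteq> t \<Longrightarrow> v i \<noteq> 0 \<Longrightarrow> d i = d p" and pos: "(\<Sum>i\<in>UNIV. d i) > 0"
  shows "arrow t d v \<in> Gamma_plus (Suc 0)"
proof -
  have "connected_component {M. transpose M = M \<and> sigma (Suc 0) M > 0}
    (arrow t d v) (arrow t (\<lambda>_. 1) (\<lambda>_. 0))"
  proof (rule connected_component_arrow)
    fix s :: real assume s: "0 \<le> s" "s \<le> 1"
    have "sigma (Suc 0) (arrow t (\<lambda>i. (1 - s) * d i + s * 1) (\<lambda>i. (1 - s) * v i + s * 0))
      = (\<Sum>i\<in>UNIV. (1 - s) * d i + s * 1)"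
      by (rule sigma_1_arrow[of p]) (use assms in auto)
    also have "\<dots> = (1 - s) * (\<Sum>i\<in>UNIV. d i) + s * CARD('n)"
      by (simp add: sum.distrib sum_distrib_left)
    also have "\<dots> > 0"
      using s pos by (cases "s = 0") (auto intro: add_nonneg_pos)
    finally show "sigma (Suc 0) (arrow t (\<lambda>i. (1 - s) * d i + s * 1) (\<lambda>i. (1 - s) * v i + s * 0)) > 0" .
  qed
  then show ?thesis
    by (simp add: Gamma_plus_def connected_component_sym_eq flip: mat_1_eq_arrow)
qed

section \<open>Gradients and Hessians\<close>

lemma continuous_on_arrow:
  fixes d v :: "'a::topological_space \<Rightarrow> 'n::finite \<Rightarrow> real"
  assumes "\<And>i. continuous_on S (\<lambda>x. d x i)" "\<And>i. continuous_on S (\<lambda>x. v x i)"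
  shows "continuous_on S (\<lambda>x. arrow t (d x) (v x))"
proof -
  have "continuous_on S (\<lambda>x. arrow t (d x) (v x) $ i $ j)" for i j
    using assms by (cases "i = j"; cases "i = t"; cases "j = t") (simp_all add: arrow_def)
  then have "continuous_on S (\<lambda>x. \<chi> i j. arrow t (d x) (v x) $ i $ j)"
    by (intro continuous_on_vec_lambda)
  then show ?thesis by simp
qed

lemma has_derivative_vec_componentwise:
  fixes f :: "'a::real_normed_vector \<Rightarrow> real^'n"
  assumes "\<And>i. ((\<lambda>x. f x $ i) has_derivative (\<lambda>h. f' h $ i)) (at x)"
  shows "(f has_derivative f') (at x)"
  using assms
  by (subst has_derivative_componentwise_within) (auto simp: Basis_vec_def inner_axis)

text \<open>By uniqueness of derivatives, guessed fields \<open>G\<close> and \<open>H\<close> only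
  have to be verified.\<close>

lemma
  assumes u: "\<And>x. (u has_derivative (\<lambda>h. G x \<bullet> h)) (at x)"
    and G: "\<And>x. (G has_derivative (\<lambda>h. H x *v h)) (at x)"
  shows hessianI: "hessian u = H"
    and twice_cont_differentiableI: "continuous_on UNIV H \<Longrightarrow> twice_cont_differentiable u"
proof -
  have "grad u = G"
    unfolding grad_def using frechet_derivative_at[OF u]
    by (auto simp: fun_eq_iff vec_eq_iff inner_axis simp flip: frechet_derivative_at[OF u])
  then show H: "hessian u = H"
    unfolding hessian_def \<open>grad u = G\<close>
    by (simp add: jacobian_def fun_eq_iff flip: frechet_derivative_at[OF G])
  show "twice_cont_differentiable u" if "continuous_on UNIV H"
    unfolding twice_cont_differentiable_def H \<open>grad u = G\<close>
    using that u G by (auto simp: differentiable_def)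
qed

lemma arrow_mult_vec:
  fixes d v :: "'n::finite \<Rightarrow> real"
  shows "(arrow t d v *v h) $ i
    = (if i = t then d t * h $ t + (\<Sum>j\<in>UNIV - {t}. v j * h $ j) else d i * h $ i + v i * h $ t)"
proof (cases "i = t")
  case True
  then have "(arrow t d v *v h) $ i = d t * h $ t + (\<Sum>j\<in>UNIV - {t}. arrow t d v $ t $ j * h $ j)"
    by (simp add: matrix_vector_mult_def sum.remove[of UNIV t] arrow_def)
  also have "(\<Sum>j\<in>UNIV - {t}. arrow t d v $ t $ j * h $ j) = (\<Sum>j\<in>UNIV - {t}. v j * h $ j)"
    by (rule sum.cong) (auto simp: arrow_def)
  finally show ?thesis using True by simp
next
  case False
  have "(arrow t d v *v h) $ i = (\<Sum>j\<in>{t, i}. arrow t d v $ i $ j * h $ j)"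
    unfolding matrix_vector_mult_def vec_lambda_beta
    using False by (intro sum.mono_neutral_right) (auto simp: arrow_def)
  then show ?thesis
    using False by (simp add: arrow_def)
qed

section \<open>Non-polynomiality\<close>

text \<open>Dividing a polynomial expression for \<open>exp\<close> by \<open>exp\<close> gives the
  constant 1, yet every term tends to 0 at infinity.\<close>

lemma exp_not_real_polynomial_function: "\<not> real_polynomial_function (exp :: real \<Rightarrow> real)"
proof
  assume "real_polynomial_function (exp :: real \<Rightarrow> real)"
  then obtain a n where exp: "(exp :: real \<Rightarrow> real) = (\<lambda>x. \<Sum>i\<le>n. a i * x ^ i)"
    by (auto simp: real_polynomial_function_iff_sum)
  have "((\<lambda>x. \<Sum>i\<le>n. a i * (x ^ i / exp x)) \<longlongrightarrow> (\<Sum>i\<le>n. a i * 0)) at_top"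
    by (intro tendsto_sum tendsto_mult tendsto_const tendsto_power_div_exp_0)
  moreover have "(\<lambda>x. \<Sum>i\<le>n. a i * (x ^ i / exp x)) = (\<lambda>x::real. 1)"
  proof
    fix x :: real
    have "(\<Sum>i\<le>n. a i * (x ^ i / exp x)) = exp x / exp x"
      by (subst (2) exp) (simp add: sum_divide_distrib)
    then show "(\<Sum>i\<le>n. a i * (x ^ i / exp x)) = 1" by simp
  qed
  ultimately have "((\<lambda>x::real. 1 :: real) \<longlongrightarrow> 0) at_top" by simp
  then show False
    by (simp add: tendsto_const_iff)
qed

text \<open>Reduces non-polynomiality to one variable, where it is refuted by recovering
  \<open>exp\<close>.\<close>

lemma real_polynomial_function_affine_line:
  fixes u :: "real^'n \<Rightarrow> real"
  assumes "real_polynomial_function u"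
  shows "real_polynomial_function (\<lambda>s::real. u (a + s *\<^sub>R b))"
proof -
  have "polynomial_function (\<lambda>s::real. a + s *\<^sub>R b)"
    by (intro polynomial_function_add polynomial_function_const polynomial_function_bounded_linear
        bounded_linear_scaleR_left)
  then show ?thesis
    using real_polynomial_function_compose[OF _ assms] by (simp add: o_def)
qed

section \<open>The solution for \<open>k = 1\<close>\<close>

lemma ex_solution_1:
  assumes "CARD('n::finite) \<ge> 2"
  shows "\<exists>u :: real^'n \<Rightarrow> real. elliptic_entire_solution (Suc 0) u \<and> \<not> real_polynomial_function u"
proof -
  have "\<not> (\<forall>p q :: 'n. p = q)"
  proof
    assume "\<forall>p q :: 'n. p = q"
    then have "CARD('n) \<le> card {undefined :: 'n}" by (intro card_mono) auto
    with assms show False by simp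
  qed
  then obtain p q :: 'n where pq: "p \<noteq> q" by auto
  define u :: "real^'n \<Rightarrow> real" where "u x = exp (x $ p) * cos (x $ q) + (x $ p)\<^sup>2 / 2" for x
  \<comment> \<open>Membership in \<open>{p}\<close> follows the shape of \<open>spike\<close> and
    \<open>sum_spike\<close>, with \<open>S = {p}\<close> and tip \<open>q\<close>.\<close>
  define G :: "real^'n \<Rightarrow> real^'n" where
    "G x = (\<chi> i. if i = q then - exp (x $ p) * sin (x $ q)
      else if i \<in> {p} then exp (x $ p) * cos (x $ q) + x $ p else 0)" for x
  define d where "d x = spike q {p} (- exp (x $ p) * cos (x $ q)) (exp (x $ p) * cos (x $ q) + 1)"
    for x :: "real^'n"
  define v where "v x i = (if i = p then - exp (x $ p) * sin (x $ q) else 0)" for x :: "real^'n" and i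
  have u: "(u has_derivative (\<lambda>h. G x \<bullet> h)) (at x)" for x
  proof -
    have "G x \<bullet> h = - exp (x $ p) * sin (x $ q) * h $ q + (exp (x $ p) * cos (x $ q) + x $ p) * h $ p" for h
    proof -
      have "G x \<bullet> h = (\<Sum>i\<in>UNIV. if i = q then - exp (x $ p) * sin (x $ q) * h $ q
        else if i \<in> {p} then (exp (x $ p) * cos (x $ q) + x $ p) * h $ i else 0)"
        unfolding inner_vec_def inner_real_def by (rule sum.cong) (auto simp: G_def)
      then show ?thesis using pq by (subst (asm) sum_spike) auto
    qed
    then show ?thesis
      unfolding u_def
      by (auto intro!: derivative_eq_intros bounded_linear.has_derivative[OF bounded_linear_vec_nth]
          simp: algebra_simps)
  qed
  have G: "(G has_derivative (\<lambda>h. arrow q (d x) (v x) *v h)) (at x)" for x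
  proof (rule has_derivative_vec_componentwise)
    have s: "(\<Sum>j\<in>UNIV - {q}. v x j * h $ j) = - exp (x $ p) * sin (x $ q) * h $ p" for h
      using pq by (subst sum.mono_neutral_right[of _ "{p}"]) (auto simp: v_def)
    show "((\<lambda>x. G x $ i) has_derivative (\<lambda>h. (arrow q (d x) (v x) *v h) $ i)) (at x)" for i
      unfolding arrow_mult_vec s
      using pq by (cases "i = q"; cases "i = p")
        (auto intro!: derivative_eq_intros bounded_linear.has_derivative[OF bounded_linear_vec_nth]
          simp: G_def d_def v_def spike_def algebra_simps)
  qed
  have d: "d x i = d x p" if "i \<noteq> q" "v x i \<noteq> 0" for x i
    using that by (auto simp: v_def split: if_splits)
  have sum_d: "(\<Sum>i\<in>UNIV. d x i) = 1" for x
    unfolding d_def spike_def using pq by (subst sum_spike) auto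
  have sigma: "sigma (Suc 0) (arrow q (d x) (v x)) = 1" for x
    by (subst sigma_1_arrow[of p]) (use pq d sum_d in auto)
  have Gamma: "arrow q (d x) (v x) \<in> Gamma_plus (Suc 0)" for x
    by (rule arrow_in_Gamma_plus_1[of p]) (use pq d sum_d in auto)
  have "continuous_on UNIV (\<lambda>x. d x i)" for i
    unfolding d_def spike_def by (cases "i = q"; cases "i = p") (simp_all add: continuous_intros)
  moreover have "continuous_on UNIV (\<lambda>x. v x i)" for i
    unfolding v_def by (cases "i = p") (simp_all add: continuous_intros)
  ultimately have "continuous_on UNIV (\<lambda>x. arrow q (d x) (v x))"
    by (rule continuous_on_arrow)
  then have "elliptic_entire_solution (Suc 0) u"
    unfolding elliptic_entire_solution_def hessianI[OF u G]
    using twice_cont_differentiableI[OF u G] sigma Gamma by auto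
  moreover have "\<not> real_polynomial_function u"
  proof
    \<comment> \<open>On the \<open>p\<close>-axis the cosine is 1, so subtracting this quadratic
      from \<open>u\<close> leaves \<open>exp\<close>.\<close>
    have sq: "real_polynomial_function (\<lambda>s::real. s * s * (1 / 2))"
      by (intro real_polynomial_function.intros(2,4) real_polynomial_function.intros(1)
          bounded_linear_ident)
    assume "real_polynomial_function u"
    then have "real_polynomial_function (\<lambda>s. u (0 + s *\<^sub>R axis p 1) - s * s * (1 / 2))"
      by (intro real_polynomial_function_diff real_polynomial_function_affine_line sq)
    moreover have "(\<lambda>s. u (0 + s *\<^sub>R axis p 1) - s * s * (1 / 2)) = exp"
      using pq by (auto simp: u_def axis_def power2_eq_square)
    ultimately show False
      using exp_not_real_polynomial_function by simp
  qed
  ultimately show ?thesis by blast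
qed

section \<open>The solution for \<open>k = j + 1\<close> with \<open>j \<ge> 1\<close>\<close>

lemma ex_solution_Suc:
  assumes "j \<ge> 1" and "CARD('n::finite) \<ge> 2 * j + 1"
  shows "\<exists>u :: real^'n \<Rightarrow> real. elliptic_entire_solution (Suc j) u \<and> \<not> real_polynomial_function u"
proof -
  obtain t :: 'n where True by simp
  have "card (UNIV - {t}) \<ge> 2 * j"
    using assms by (simp add: card_Diff_singleton)
  then obtain S where S: "S \<subseteq> UNIV - {t}" "card S = 2 * j"
    by (metis obtain_subset_with_card_n)
  then have tS: "t \<notin> S" by auto
  obtain p where pS: "p \<in> S"
    using S assms by (cases "S = {}") auto
  \<comment> \<open>Two integrations of the required \<open>h''\<close> give
    \<open>h t = \<kappa> * exp (- j * t) - \<beta> * exp t\<close>; the square of \<open>j\<close>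
    in \<kappa> comes from them.\<close>
  define \<kappa> \<beta> where "\<kappa> = 1 / ((real j)\<^sup>2 * real ((2 * j) choose j))"
    and "\<beta> = real ((2 * j) choose Suc j) / real ((2 * j) choose j)"
  define r :: "real^'n \<Rightarrow> real" where "r x = (\<Sum>i\<in>S. (x $ i)\<^sup>2 / 2)" for x
  define u :: "real^'n \<Rightarrow> real" where
    "u x = exp (x $ t) * r x + \<kappa> * exp (- real j * x $ t) - \<beta> * exp (x $ t)" for x
  define G :: "real^'n \<Rightarrow> real^'n" where
    "G x = (\<chi> i. if i = t then exp (x $ t) * r x - \<kappa> * real j * exp (- real j * x $ t) - \<beta> * exp (x $ t)
      else if i \<in> S then exp (x $ t) * x $ i else 0)" for x
  define c where
    "c x = exp (x $ t) * r x + \<kappa> * (real j)\<^sup>2 * exp (- real j * x $ t) - \<beta> * exp (x $ t)" for x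
  define v where "v x i = (if i \<in> S then exp (x $ t) * x $ i else 0)" for x :: "real^'n" and i
  define H where "H x = arrow t (spike t S (c x) (exp (x $ t))) (v x)" for x
  have r: "(r has_derivative (\<lambda>h. \<Sum>i\<in>S. x $ i * h $ i)) (at x)" for x
    unfolding r_def
    by (auto intro!: derivative_eq_intros bounded_linear.has_derivative[OF bounded_linear_vec_nth]
        simp: mult.commute)
  have v: "v x i = 0" if "i \<notin> S" for x i
    using that by (simp add: v_def)
  \<comment> \<open>Stated for general \<open>f\<close> to serve both the product with
    \<open>h\<close> in the derivative of \<open>G\<close> and the squared border norm in
    \<sigma>.\<close>
  have sum_v: "(\<Sum>i\<in>UNIV - {t}. f (v x i) i) = (\<Sum>i\<in>S. f (exp (x $ t) * x $ i) i)"
    if "\<And>i. f 0 i = 0" for x and f :: "real \<Rightarrow> 'n \<Rightarrow> real"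
    using that tS by (intro sum.mono_neutral_cong_right) (auto simp: v_def)
  have u: "(u has_derivative (\<lambda>h. G x \<bullet> h)) (at x)" for x
  proof -
    have "G x \<bullet> h = G x $ t * h $ t + (\<Sum>i\<in>S. exp (x $ t) * x $ i * h $ i)" for h
    proof -
      have "G x \<bullet> h = (\<Sum>i\<in>UNIV. if i = t then G x $ t * h $ t
        else if i \<in> S then exp (x $ t) * x $ i * h $ i else 0)"
        unfolding inner_vec_def inner_real_def by (rule sum.cong) (auto simp: G_def)
      then show ?thesis using tS by (subst (asm) sum_spike) auto
    qed
    moreover have "(u has_derivative (\<lambda>h. G x $ t * h $ t + (\<Sum>i\<in>S. exp (x $ t) * x $ i * h $ i))) (at x)"
      unfolding u_def
      by (auto intro!: derivative_eq_intros bounded_linear.has_derivative[OF bounded_linear_vec_nth] r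
          simp: G_def sum_distrib_left algebra_simps)
    ultimately show ?thesis by simp
  qed
  have G: "(G has_derivative (\<lambda>h. H x *v h)) (at x)" for x
  proof (rule has_derivative_vec_componentwise)
    have s: "(\<Sum>j\<in>UNIV - {t}. v x j * h $ j) = (\<Sum>i\<in>S. exp (x $ t) * x $ i * h $ i)" for h
      by (rule sum_v[of "\<lambda>a i. a * h $ i"]) simp
    show "((\<lambda>x. G x $ i) has_derivative (\<lambda>h. (H x *v h) $ i)) (at x)" for i
      unfolding H_def arrow_mult_vec s
      using tS by (cases "i = t"; cases "i \<in> S")
        (auto intro!: derivative_eq_intros bounded_linear.has_derivative[OF bounded_linear_vec_nth] r
          simp: G_def c_def v_def spike_def sum_distrib_left algebra_simps power2_eq_square)
  qed
  \<comment> \<open>Now \<open>Suc j\<close> is \<open>Suc (Suc k)\<close>, as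
    \<open>sigma_spike\<close> and \<open>spike_in_Gamma_plus\<close> expect.\<close>
  obtain k where k: "j = Suc k" using assms by (cases j) auto
  have sigma: "sigma (Suc j) (H x) = 1" for x
  proof -
    define E where "E = exp (x $ t)"
    have E: "exp (- real j * x $ t) * E ^ j = 1"
      unfolding E_def exp_of_nat_mult[symmetric] by (simp flip: exp_add)
    \<comment> \<open>This identity forces the size \<open>2 * j\<close> of \<open>S\<close>: it
      lets the border term cancel the \<open>r x\<close> part of the corner term.\<close>
    have "j * ((2 * j) choose j) = j * (2 * ((2 * j - 1) choose k))"
      using binomial_absorption[of k "2 * j"] by (simp add: k)
    then have "(2 * j) choose j = 2 * ((2 * j - 1) choose k)"
      using assms by simp
    then have binom: "real ((2 * j) choose j) = 2 * real ((2 * j - 1) choose k)"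
      by linarith
    have bpos: "real ((2 * j) choose j) > 0" by simp
    have "(\<Sum>i\<in>UNIV - {t}. (v x i)\<^sup>2) = E\<^sup>2 * (2 * r x)"
      using sum_v[of "\<lambda>a i. a\<^sup>2"] by (simp add: E_def r_def power_mult_distrib sum_distrib_left)
    then have "sigma (Suc j) (H x) = ((2 * j) choose Suc j) * E ^ Suc j
        + c x * ((2 * j) choose j) * E ^ j - E\<^sup>2 * (2 * r x) * (((2 * j - 1) choose k) * E ^ k)"
      unfolding H_def k
      by (subst sigma_spike[OF tS pS]) (use S v in \<open>auto simp: k E_def\<close>)
    also have "E\<^sup>2 * (2 * r x) * (((2 * j - 1) choose k) * E ^ k) = E * r x * ((2 * j) choose j) * E ^ j"
      unfolding binom by (simp add: k power2_eq_square)
    also have "c x = E * r x + \<kappa> * (real j)\<^sup>2 * exp (- real j * x $ t) - \<beta> * E"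
      by (simp add: c_def E_def)
    also have "((2 * j) choose Suc j) * E ^ Suc j
        + (E * r x + \<kappa> * (real j)\<^sup>2 * exp (- real j * x $ t) - \<beta> * E) * ((2 * j) choose j) * E ^ j
        - E * r x * ((2 * j) choose j) * E ^ j
      = (((2 * j) choose Suc j) - \<beta> * ((2 * j) choose j)) * E ^ Suc j
        + (\<kappa> * (real j)\<^sup>2 * ((2 * j) choose j)) * (exp (- real j * x $ t) * E ^ j)"
      by (simp add: algebra_simps)
    also have "\<dots> = 1"
      unfolding E \<kappa>_def \<beta>_def using bpos assms by simp
    finally show ?thesis .
  qed
  \<comment> \<open>Positivity is \<open>sigma\<close>, and \<open>j \<ge> 1\<close> gives
    \<open>j + 1 \<le> 2 * j\<close>, the size of \<open>S\<close>.\<close>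
  have Gamma: "H x \<in> Gamma_plus (Suc j)" for x
    unfolding H_def k
    by (rule spike_in_Gamma_plus[OF tS pS])
      (use v S assms sigma[of x] in \<open>auto simp: k H_def\<close>)
  have "continuous_on UNIV c"
    unfolding c_def r_def by (intro continuous_intros) simp
  then have "continuous_on UNIV (\<lambda>x. spike t S (c x) (exp (x $ t)) i)" for i
    unfolding spike_def by (cases "i = t"; cases "i \<in> S") (simp_all add: continuous_intros)
  moreover have "continuous_on UNIV (\<lambda>x. v x i)" for i
    unfolding v_def by (cases "i \<in> S") (simp_all add: continuous_intros)
  ultimately have "continuous_on UNIV H"
    unfolding H_def by (rule continuous_on_arrow)
  then have "elliptic_entire_solution (Suc j) u"
    unfolding elliptic_entire_solution_def hessianI[OF u G]
    using twice_cont_differentiableI[OF u G] sigma Gamma by auto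
  moreover have "\<not> real_polynomial_function u"
  proof
    assume "real_polynomial_function u"
    \<comment> \<open>On these two parallel lines the terms depending on \<open>x $ t\<close> alone
      agree, while \<open>r\<close> is 1/2 on one and 0 on the other; doubling the difference gives
      \<open>exp\<close>.\<close>
    then have "real_polynomial_function
      (\<lambda>s. 2 * (u (axis p 1 + s *\<^sub>R axis t 1) - u (0 + s *\<^sub>R axis t 1)))"
      by (intro real_polynomial_function.intros(2,4) real_polynomial_function_diff real_polynomial_function_affine_line)
    moreover have "(\<lambda>s. 2 * (u (axis p 1 + s *\<^sub>R axis t 1) - u (0 + s *\<^sub>R axis t 1))) = exp"
    proof
      fix s
      have "p \<noteq> t" using pS tS by auto
      have "r (axis p 1 + s *\<^sub>R axis t 1) = (\<Sum>i\<in>{p}. 1 / 2)"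
        unfolding r_def using pS tS by (intro sum.mono_neutral_cong_right) (auto simp: axis_def)
      moreover have "r (0 + s *\<^sub>R axis t 1) = 0"
        unfolding r_def using tS by (intro sum.neutral) (auto simp: axis_def)
      ultimately show "2 * (u (axis p 1 + s *\<^sub>R axis t 1) - u (0 + s *\<^sub>R axis t 1)) = exp s"
        unfolding u_def using \<open>p \<noteq> t\<close> by (simp add: axis_def algebra_simps)
    qed
    ultimately show False
      using exp_not_real_polynomial_function by simp
  qed
  ultimately show ?thesis by blast
qed

text \<open>For \<open>n = k = 1\<close> the equation reads \<open>u'' = 1\<close> and has only
  quadratic solutions, hence the exclusion. With \<open>k = j + 1\<close> the bound
  \<open>2 * k - 1\<close> is \<open>2 * j + 1\<close>: the set \<open>S\<close> together with the
  tip.\<close>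

theorem theorem1:
  fixes k :: nat
  assumes "k \<ge> 1"
    and "CARD('n::finite) \<ge> 2 * k - 1"
    and "\<not> (CARD('n) = 1 \<and> k = 1)"
  shows "\<exists>u :: real^'n \<Rightarrow> real. elliptic_entire_solution k u \<and> \<not> real_polynomial_function u"
proof (cases "k = 1")
  case True
  moreover have "CARD('n) > 0" by simp
  ultimately have "CARD('n) \<ge> 2" using assms(3) by linarith
  with True show ?thesis
    using ex_solution_1[where 'n = 'n] by simp
next
  case False
  with assms obtain j where "k = Suc j" "j \<ge> 1" by (cases k) auto
  then show ?thesis
    using ex_solution_Suc[where 'n = 'n, of j] assms by auto
qed

end
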